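(* Let $\mathcal{T}$ be a completely regular Souslin topology on the Skorokhod space $\mathbb{D}(I;\mathbb{R}^d)$ that is comparable to Jakubowski's $S$-topology $S$ (i.e. $\mathcal{T}\subset S$ or $S\subset\mathcal{T}$) and has the same compact sets, $\mathcal{K}(\mathcal{T})=\mathcal{K}(S)$. Then $$\mathcal{T}\subset S.$$
   Context: $I$ is $[0,T]$ with $0<T\le\infty$, or $I=[0,\infty)$; $d\in\mathbb{N}$. $\mathbb{D}(I;\mathbb{R}^d)$ is the set of c\`adl\`ag functions $\omega=(\omega^1,\dots,\omega^d):I\to\mathbb{R}^d$; $\mathbb{D}([0,\infty];\mathbb{R}^d)$ is regarded as the product $\mathbb{D}([0,\infty);\mathbb{R}^d)\times\mathbb{R}^d$ with the Euclidean topology on $\mathbb{R}^d$. $\mathcal{K}(\cdot)$ denotes the family of compact sets of a topology. All topological spaces are Hausdorff. Completely regular means: for each point $x$ and closed set $Z\not\ni x$ there is a continuous $f$ into $[0,1]$ with $f(x)=1$ and $f=0$ on $Z$. A Souslin topology is one for which the space is the image of a complete separable metric space under a continuous mapping. $S$-topology: on $\mathbb{D}([0,T];\mathbb{R}^d)$, $T<\infty$, write $\omega_n\to_S\omega_0$ if for every $i\le d$ and $\varepsilon>0$ there are functions $(\nu_n^{i,\varepsilon})_{n\ge 0}$ of finite variation on $[0,T]$ with $\|\omega_n^i-\nu_n^{i,\varepsilon}\|_\infty\le\varepsilon$ for all $n\ge0$ and $\nu_n^{i,\varepsilon}\to\nu_0^{i,\varepsilon}$ in the weak${}^*$ topology obtained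 by identifying finite-variation functions on $[0,T]$ with the Banach dual of $C([0,T])$. On $\mathbb{D}([0,\infty);\mathbb{R}^d)$, write $\omega_n\to_S\omega_0$ if for every $i\le d$ there are positive reals $T^r\uparrow\infty$ such that the restrictions of $\omega^i_n$ to $[0,T^r]$ $S$-converge to the restriction of $\omega_0^i$ for every $r$. The $S$-topology is the sequential topology generated by subsequential $S$-convergence: a set is closed iff it contains the limit $\omega_0$ of every sequence of its elements such that each subsequence has a further subsequence $S$-converging to $\omega_0$. *)

theory Defs
  imports "HOL-Analysis.Analysis"
begin

section \<open>The Skorokhod space\<close>

definition cadlag_on :: "real set \<Rightarrow> (real \<Rightarrow> 'a::topological_space) \<Rightarrow> bool" where
  "cadlag_on J x \<longleftrightarrow>
     (\<forall>t\<in>J. (x \<longlongrightarrow> x t) (at t within J \<inter> {t<..}) \<and>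
            (\<exists>l. (x \<longlongrightarrow> l) (at t within J \<inter> {..<t})))"

text \<open>
  Time is extended real so that \<open>{0..T}\<close> with \<open>T < \<infinity>\<close>, \<open>{0..<\<infinity>}\<close> and \<open>{0..\<infinity>}\<close> are treated
  together. The cadlag condition is imposed at finite times only: for \<open>I = {0..\<infinity>}\<close> no left limit
  is required at \<open>\<infinity>\<close>, the value there is arbitrary, and \<open>\<omega> \<mapsto> (\<omega> restricted to {0..<\<infinity>}, \<omega> \<infinity>)\<close>
  is a bijection onto the product of the space over \<open>{0..<\<infinity>}\<close> with the value space.
\<close>

definition skorokhod_space :: "ereal set \<Rightarrow> (ereal \<Rightarrow> 'a::topological_space) set" where
  "skorokhod_space I = {\<omega> \<in> extensional I. cadlag_on (ereal -` I) (\<lambda>t. \<omega> (ereal t))}"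

section \<open>Functions of finite variation as functionals on continuous functions\<close>

definition is_partition :: "real \<Rightarrow> real \<Rightarrow> nat \<Rightarrow> (nat \<Rightarrow> real) \<Rightarrow> bool" where
  "is_partition a b N t \<longleftrightarrow> t 0 = a \<and> t N = b \<and> (\<forall>k<N. t k \<le> t (Suc k))"

definition finite_variation_on :: "real \<Rightarrow> real \<Rightarrow> (real \<Rightarrow> real) \<Rightarrow> bool" where
  "finite_variation_on a b \<nu> \<longleftrightarrow>
     (\<exists>B. \<forall>N t. is_partition a b N t \<longrightarrow> (\<Sum>k<N. \<bar>\<nu> (t (Suc k)) - \<nu> (t k)\<bar>) \<le> B)"

definition has_stieltjes_integral ::
    "(real \<Rightarrow> real) \<Rightarrow> (real \<Rightarrow> real) \<Rightarrow> real \<Rightarrow> real \<Rightarrow> real \<Rightarrow> bool" where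
  "has_stieltjes_integral f \<nu> a b L \<longleftrightarrow>
     (\<forall>e>0. \<exists>\<delta>>0. \<forall>N t \<xi>.
        is_partition a b N t \<and> (\<forall>k<N. t k \<le> \<xi> k \<and> \<xi> k \<le> t (Suc k) \<and> t (Suc k) - t k < \<delta>)
        \<longrightarrow> \<bar>(\<Sum>k<N. f (\<xi> k) * (\<nu> (t (Suc k)) - \<nu> (t k))) - L\<bar> < e)"

definition stieltjes_integral ::
    "(real \<Rightarrow> real) \<Rightarrow> (real \<Rightarrow> real) \<Rightarrow> real \<Rightarrow> real \<Rightarrow> real" where
  "stieltjes_integral f \<nu> a b = (THE L. has_stieltjes_integral f \<nu> a b L)"

text \<open>
  The identification with the dual of \<open>C([0,T])\<close> (Riesz): a cadlag function \<open>\<nu>\<close> of finite variation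
  corresponds to the signed measure \<open>\<mu>\<close> with \<open>\<mu> [0,t] = \<nu> t\<close> for all \<open>t \<in> [0,T]\<close>. In other words
  \<open>\<nu>\<close> is taken to vanish before time \<open>0\<close>, so that \<open>\<mu>\<close> has mass \<open>\<nu> 0\<close> at \<open>0\<close>; this is the first
  summand below.
\<close>

definition stieltjes_pairing :: "real \<Rightarrow> (real \<Rightarrow> real) \<Rightarrow> (real \<Rightarrow> real) \<Rightarrow> real" where
  "stieltjes_pairing T \<nu> f = f 0 * \<nu> 0 + stieltjes_integral f \<nu> 0 T"

definition weak_star_converges :: "real \<Rightarrow> (nat \<Rightarrow> real \<Rightarrow> real) \<Rightarrow> (real \<Rightarrow> real) \<Rightarrow> bool" where
  "weak_star_converges T \<nu> \<nu>\<^sub>0 \<longleftrightarrow>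
     (\<forall>f. continuous_on {0..T} f \<longrightarrow>
        (\<lambda>n. stieltjes_pairing T (\<nu> n) f) \<longlonglongrightarrow> stieltjes_pairing T \<nu>\<^sub>0 f)"

section \<open>S-convergence\<close>

text \<open>
  Throughout, the limit is a separate argument rather than the term with index \<open>0\<close>. The cadlag
  normalisation of the approximating functions is what makes the identification with the dual of
  \<open>C([0,T])\<close> one-to-one.
\<close>

definition S_converges_real :: "real \<Rightarrow> (nat \<Rightarrow> real \<Rightarrow> real) \<Rightarrow> (real \<Rightarrow> real) \<Rightarrow> bool" where
  "S_converges_real T x x\<^sub>0 \<longleftrightarrow>
     (\<forall>\<epsilon>>0. \<exists>\<nu> \<nu>\<^sub>0.
        (\<forall>n. cadlag_on {0..T} (\<nu> n) \<and> finite_variation_on 0 T (\<nu> n)) \<and>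
        cadlag_on {0..T} \<nu>\<^sub>0 \<and> finite_variation_on 0 T \<nu>\<^sub>0 \<and>
        (\<forall>n. \<forall>t\<in>{0..T}. \<bar>x n t - \<nu> n t\<bar> \<le> \<epsilon>) \<and>
        (\<forall>t\<in>{0..T}. \<bar>x\<^sub>0 t - \<nu>\<^sub>0 t\<bar> \<le> \<epsilon>) \<and>
        weak_star_converges T \<nu> \<nu>\<^sub>0)"

definition S_converges_compact ::
    "real \<Rightarrow> (nat \<Rightarrow> ereal \<Rightarrow> real ^ 'd) \<Rightarrow> (ereal \<Rightarrow> real ^ 'd) \<Rightarrow> bool" where
  "S_converges_compact T \<omega> \<omega>\<^sub>0 \<longleftrightarrow>
     (\<forall>i. S_converges_real T (\<lambda>n t. \<omega> n (ereal t) $ i) (\<lambda>t. \<omega>\<^sub>0 (ereal t) $ i))"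

definition S_converges_halfline ::
    "(nat \<Rightarrow> ereal \<Rightarrow> real ^ 'd) \<Rightarrow> (ereal \<Rightarrow> real ^ 'd) \<Rightarrow> bool" where
  "S_converges_halfline \<omega> \<omega>\<^sub>0 \<longleftrightarrow>
     (\<forall>i. \<exists>T :: nat \<Rightarrow> real. (\<forall>r. 0 < T r) \<and> incseq T \<and> filterlim T at_top sequentially \<and>
        (\<forall>r. S_converges_real (T r) (\<lambda>n t. \<omega> n (ereal t) $ i) (\<lambda>t. \<omega>\<^sub>0 (ereal t) $ i)))"

section \<open>The S-topology\<close>

definition subseq_converges :: "((nat \<Rightarrow> 'a) \<Rightarrow> 'a \<Rightarrow> bool) \<Rightarrow> (nat \<Rightarrow> 'a) \<Rightarrow> 'a \<Rightarrow> bool" where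
  "subseq_converges conv x l \<longleftrightarrow>
     (\<forall>r :: nat \<Rightarrow> nat. strict_mono r \<longrightarrow>
        (\<exists>s :: nat \<Rightarrow> nat. strict_mono s \<and> conv (x \<circ> r \<circ> s) l))"

definition seq_closed :: "'a set \<Rightarrow> ((nat \<Rightarrow> 'a) \<Rightarrow> 'a \<Rightarrow> bool) \<Rightarrow> 'a set \<Rightarrow> bool" where
  "seq_closed X conv A \<longleftrightarrow>
     A \<subseteq> X \<and> (\<forall>x l. (\<forall>n. x n \<in> A) \<and> l \<in> X \<and> subseq_converges conv x l \<longrightarrow> l \<in> A)"

definition sequential_topology :: "'a set \<Rightarrow> ((nat \<Rightarrow> 'a) \<Rightarrow> 'a \<Rightarrow> bool) \<Rightarrow> 'a topology" where
  "sequential_topology X conv = topology (\<lambda>U. U \<subseteq> X \<and> seq_closed X conv (X - U))"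

lemma subseq_converges_subseq:
  assumes "subseq_converges conv x l" "strict_mono q"
  shows "subseq_converges conv (x \<circ> q) l"
  unfolding subseq_converges_def
proof (intro allI impI)
  fix r :: "nat \<Rightarrow> nat" assume "strict_mono r"
  then have "strict_mono (q \<circ> r)" using assms(2) by (simp add: strict_mono_o)
  then show "\<exists>s. strict_mono s \<and> conv (x \<circ> q \<circ> r \<circ> s) l"
    using assms(1) unfolding subseq_converges_def by (metis comp_assoc)
qed

lemma seq_closed_Un:
  assumes A: "seq_closed X conv A" and B: "seq_closed X conv B"
  shows "seq_closed X conv (A \<union> B)"
  unfolding seq_closed_def
proof (intro conjI allI impI)
  show "A \<union> B \<subseteq> X" using A B by (auto simp: seq_closed_def)
next
  fix x l assume *: "(\<forall>n. x n \<in> A \<union> B) \<and> l \<in> X \<and> subseq_converges conv x l"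
  have sub: "l \<in> C" if C: "seq_closed X conv C" and inf: "infinite {n. x n \<in> C}" for C
  proof -
    obtain q :: "nat \<Rightarrow> nat" where q: "strict_mono q" "\<And>n. q n \<in> {n. x n \<in> C}"
      using infinite_enumerate[OF inf] by blast
    then have "\<forall>n. (x \<circ> q) n \<in> C" "subseq_converges conv (x \<circ> q) l"
      using * subseq_converges_subseq by auto
    then show ?thesis using C * unfolding seq_closed_def by blast
  qed
  have "{n. x n \<in> A} \<union> {n. x n \<in> B} = UNIV" using * by auto
  then have "infinite {n. x n \<in> A} \<or> infinite {n. x n \<in> B}"
    by (metis finite_Un infinite_UNIV_nat)
  then show "l \<in> A \<union> B" using sub A B by blast
qed

lemma istopology_seq_closed: "istopology (\<lambda>U. U \<subseteq> X \<and> seq_closed X conv (X - U))"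
  unfolding istopology_def
proof (intro conjI allI impI)
  fix U V
  assume "U \<subseteq> X \<and> seq_closed X conv (X - U)" "V \<subseteq> X \<and> seq_closed X conv (X - V)"
  then show "U \<inter> V \<subseteq> X" "seq_closed X conv (X - U \<inter> V)"
    using seq_closed_Un[of X conv "X - U" "X - V"] by (auto simp: Diff_Int)
next
  fix K assume K: "\<forall>U\<in>K. U \<subseteq> X \<and> seq_closed X conv (X - U)"
  then show "\<Union>K \<subseteq> X" by blast
  show "seq_closed X conv (X - \<Union>K)"
    unfolding seq_closed_def
  proof (intro conjI allI impI)
    fix x l assume *: "(\<forall>n. x n \<in> X - \<Union>K) \<and> l \<in> X \<and> subseq_converges conv x l"
    have "l \<in> X - U" if "U \<in> K" for U
    proof -
      have "\<forall>n. x n \<in> X - U" using * that by blast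
      moreover have "seq_closed X conv (X - U)" using K that by blast
      ultimately show ?thesis using * unfolding seq_closed_def by blast
    qed
    then show "l \<in> X - \<Union>K" using * by blast
  qed blast
qed

lemma openin_sequential_topology:
  "openin (sequential_topology X conv) U \<longleftrightarrow> U \<subseteq> X \<and> seq_closed X conv (X - U)"
  by (simp add: sequential_topology_def topology_inverse'[OF istopology_seq_closed])

lemma topspace_sequential_topology [simp]: "topspace (sequential_topology X conv) = X"
proof
  show "topspace (sequential_topology X conv) \<subseteq> X"
    by (auto simp: topspace_def openin_sequential_topology)
  have "openin (sequential_topology X conv) X"
    by (auto simp: openin_sequential_topology seq_closed_def)
  then show "X \<subseteq> topspace (sequential_topology X conv)"
    by (rule openin_subset)
qed

lemma closedin_sequential_topology:
  "closedin (sequential_topology X conv) A \<longleftrightarrow> seq_closed X conv A"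
proof -
  have "A \<subseteq> X" if "seq_closed X conv A" using that by (simp add: seq_closed_def)
  moreover have "X - (X - A) = A" if "A \<subseteq> X" using that by blast
  ultimately show ?thesis by (auto simp: closedin_def openin_sequential_topology)
qed

text \<open>
  Over \<open>{0..\<infinity>}\<close> the topology is the product of the S-topology over \<open>{0..<\<infinity>}\<close> and the Euclidean
  topology, transported along the bijection described above.
\<close>

definition S_topology :: "ereal set \<Rightarrow> (ereal \<Rightarrow> real ^ 'd) topology" where
  "S_topology I =
     (let H = sequential_topology (skorokhod_space {0..<\<infinity>}) S_converges_halfline in
      if I = {0..<\<infinity>} then H
      else if I = {0..\<infinity>} then
        pullback_topology (skorokhod_space I) (\<lambda>\<omega>. (restrict \<omega> {0..<\<infinity>}, \<omega> \<infinity>))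
          (prod_topology H euclidean)
      else sequential_topology (skorokhod_space I) (S_converges_compact (real_of_ereal (Sup I))))"

lemma skorokhod_space_extended_halfline:
  "bij_betw (\<lambda>\<omega>. (restrict \<omega> {0..<\<infinity>}, \<omega> \<infinity>))
     (skorokhod_space {0..\<infinity>} :: (ereal \<Rightarrow> 'a::topological_space) set)
     (skorokhod_space {0..<\<infinity>} \<times> UNIV)"
proof (rule bij_betw_byWitness[where f' = "\<lambda>(\<eta>, v). \<eta>(\<infinity> := v)"])
  have J: "ereal -` {0..<\<infinity>} = {0..}" "ereal -` {0..\<infinity>} = {0..}" by auto
  have cong: "cadlag_on {0..} x \<longleftrightarrow> cadlag_on {0..} y" if "\<And>t. 0 \<le> t \<Longrightarrow> x t = y t"
    for x y :: "real \<Rightarrow> 'a"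
  proof -
    have "(x \<longlongrightarrow> l) (at t within {0..} \<inter> A) \<longleftrightarrow> (y \<longlongrightarrow> l) (at t within {0..} \<inter> A)" for l t A
      by (rule Lim_cong_within) (auto simp: that)
    then show ?thesis unfolding cadlag_on_def using that by auto
  qed
  show "\<forall>\<omega>\<in>skorokhod_space {0..\<infinity>}. (case (restrict \<omega> {0..<\<infinity>}, \<omega> \<infinity> :: 'a) of
      (\<eta>, v) \<Rightarrow> \<eta>(\<infinity> := v)) = \<omega>"
  proof
    fix \<omega> :: "ereal \<Rightarrow> 'a" assume "\<omega> \<in> skorokhod_space {0..\<infinity>}"
    then have "\<omega> t = undefined" if "\<not> 0 \<le> t" for t
      using that by (simp add: skorokhod_space_def extensional_def)
    then show "(case (restrict \<omega> {0..<\<infinity>}, \<omega> \<infinity>) of (\<eta>, v) \<Rightarrow> \<eta>(\<infinity> := v)) = \<omega>"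
      by (simp add: fun_eq_iff restrict_def)
  qed
  show "\<forall>p\<in>skorokhod_space {0..<\<infinity>} \<times> (UNIV :: 'a set).
      (restrict (case p of (\<eta>, v) \<Rightarrow> \<eta>(\<infinity> := v)) {0..<\<infinity>}, (case p of (\<eta>, v) \<Rightarrow> \<eta>(\<infinity> := v)) \<infinity>) = p"
  proof
    fix p :: "(ereal \<Rightarrow> 'a) \<times> 'a"
    assume "p \<in> skorokhod_space {0..<\<infinity>} \<times> (UNIV :: 'a set)"
    then obtain \<eta> v where p: "p = (\<eta>, v)" and "\<eta> \<in> extensional {0..<\<infinity>}"
      by (auto simp: skorokhod_space_def)
    then have "restrict (\<eta>(\<infinity> := v)) {0..<\<infinity>} = \<eta>"
      by (intro ext) (simp add: restrict_def extensional_def)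
    then show "(restrict (case p of (\<eta>, v) \<Rightarrow> \<eta>(\<infinity> := v)) {0..<\<infinity>},
        (case p of (\<eta>, v) \<Rightarrow> \<eta>(\<infinity> := v)) \<infinity>) = p"
      by (simp add: p)
  qed
  show "(\<lambda>\<omega>. (restrict \<omega> {0..<\<infinity>}, \<omega> \<infinity> :: 'a)) ` skorokhod_space {0..\<infinity>}
      \<subseteq> skorokhod_space {0..<\<infinity>} \<times> UNIV"
  proof clarify
    fix \<omega> :: "ereal \<Rightarrow> 'a" assume "\<omega> \<in> skorokhod_space {0..\<infinity>}"
    then have "cadlag_on {0..} (\<lambda>t. \<omega> (ereal t))"
      unfolding skorokhod_space_def J by simp
    then have "cadlag_on {0..} (\<lambda>t. restrict \<omega> {0..<\<infinity>} (ereal t))"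
      by (rule cong[THEN iffD1, rotated]) simp
    then show "restrict \<omega> {0..<\<infinity>} \<in> skorokhod_space {0..<\<infinity>} \<and> \<omega> \<infinity> \<in> UNIV"
      unfolding skorokhod_space_def J by simp
  qed
  show "(\<lambda>(\<eta>, v :: 'a). \<eta>(\<infinity> := v)) ` (skorokhod_space {0..<\<infinity>} \<times> UNIV) \<subseteq> skorokhod_space {0..\<infinity>}"
  proof clarify
    fix \<eta> :: "ereal \<Rightarrow> 'a" and v :: 'a assume \<eta>: "\<eta> \<in> skorokhod_space {0..<\<infinity>}"
    then have "\<eta>(\<infinity> := v) \<in> extensional {0..\<infinity>}"
      by (simp add: skorokhod_space_def extensional_def)
    with \<eta> show "\<eta>(\<infinity> := v) \<in> skorokhod_space {0..\<infinity>}"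
      unfolding skorokhod_space_def J by simp
  qed
qed

lemma topspace_S_topology [simp]:
  "topspace (S_topology I :: (ereal \<Rightarrow> real ^ 'd) topology) = skorokhod_space I"
proof -
  have "skorokhod_space I \<subseteq> (\<lambda>\<omega>. (restrict \<omega> {0..<\<infinity>}, \<omega> \<infinity>)) -`
      (skorokhod_space {0..<\<infinity>} \<times> (UNIV :: (real ^ 'd) set))" if "I = {0..\<infinity>}"
    using bij_betw_apply[OF skorokhod_space_extended_halfline] that by blast
  then show ?thesis
    by (simp add: S_topology_def Let_def topspace_pullback_topology Int_absorb1)
qed

section \<open>Souslin topologies\<close>

text \<open>
  HOL cannot quantify over types inside a formula, so the carrier type \<open>'b\<close> of the complete
  separable metric space is a parameter; leaving it free in a theorem makes the hypothesis cover
  complete separable metric spaces over arbitrary types.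
\<close>

definition souslin_space :: "'b itself \<Rightarrow> 'a topology \<Rightarrow> bool" where
  "souslin_space _ X \<longleftrightarrow>
     (\<exists>(M :: 'b set) d f. Metric_space M d \<and> Metric_space.mcomplete M d \<and>
        separable_space (Metric_space.mtopology M d) \<and>
        continuous_map (Metric_space.mtopology M d) X f \<and> f ` M = topspace X)"

end

theory Submission
  imports Defs
begin

text \<open>
  The S-topology is sequential, so it suffices that a \<open>\<T>\<close>-closed set \<open>C\<close> contains the S-limit \<open>l\<close> of
  each sequence \<open>x\<close> in \<open>C\<close>. If \<open>l \<notin> C\<close>, then for every subset \<open>D\<close> of the range of \<open>x\<close> the set
  \<open>D \<union> {l}\<close> is S-compact, hence \<open>\<T>\<close>-compact, so its trace \<open>D\<close> on \<open>C\<close> is \<open>\<T>\<close>-compact and thus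
  \<open>\<T>\<close>-closed. Therefore the range of \<open>x\<close> is compact and discrete in \<open>\<T>\<close>, hence finite, and some
  constant subsequence converges to \<open>l\<close> in S, which contradicts that points are S-closed.

  Points are S-closed because weak* convergence of functions of finite variation yields convergence
  of their integrals over subintervals and of their terminal values; this determines the S-limit of
  a constant sequence, by right continuity. Over \<open>{0..\<infinity>}\<close>, sequentiality of the S-topology comes from
  the local compactness of the Euclidean factor.
\<close>

section \<open>Stieltjes integrals against functions of finite variation\<close>

text \<open>\<open>V\<close> is the total variation on the interval from \<open>a\<close> to
  \<open>t\<close>. Appending \<open>t\<close> to a partition ending at \<open>s\<close> adds
  exactly the absolute increment of \<open>\<nu>\<close> to its sum; passing to the supremum gives
  the bound. It serves both the integrability of \<open>\<nu>\<close> and the error estimate for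
  Riemann-Stieltjes sums.\<close>

lemma finite_variation_on_control:
  assumes "finite_variation_on a b \<nu>"
  obtains V where "\<And>s t. a \<le> s \<Longrightarrow> s \<le> t \<Longrightarrow> t \<le> b \<Longrightarrow> \<bar>\<nu> t - \<nu> s\<bar> \<le> V t - V s"
proof
  obtain B where B: "\<And>N p. is_partition a b N p \<Longrightarrow> (\<Sum>k<N. \<bar>\<nu> (p (Suc k)) - \<nu> (p k)\<bar>) \<le> B"
    using assms unfolding finite_variation_on_def by blast
  define A where "A t = {(\<Sum>k<N. \<bar>\<nu> (p (Suc k)) - \<nu> (p k)\<bar>) | N p. is_partition a t N p}" for t
  define V where "V t = Sup (A t)" for t
  have extend: "\<exists>y\<in>A t. y = x + \<bar>\<nu> t - \<nu> s\<bar>" if x: "x \<in> A s" and "s \<le> t" for s t x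
  proof -
    obtain N p where p: "is_partition a s N p" and x: "x = (\<Sum>k<N. \<bar>\<nu> (p (Suc k)) - \<nu> (p k)\<bar>)"
      using x by (auto simp: A_def)
    define q where "q k = (if k \<le> N then p k else t)" for k
    have "(\<Sum>k<Suc N. \<bar>\<nu> (q (Suc k)) - \<nu> (q k)\<bar>) = x + \<bar>\<nu> t - \<nu> s\<bar>"
      using p by (simp add: x q_def is_partition_def)
    moreover have "is_partition a t (Suc N) q"
      using p \<open>s \<le> t\<close> by (auto simp: q_def is_partition_def less_Suc_eq)
    ultimately show ?thesis unfolding A_def by (metis (mono_tags, lifting) mem_Collect_eq)
  qed
  \<comment> \<open>The bound \<open>B\<close> concerns partitions of the whole interval only;
    appending \<open>b\<close> to a partition that ends at \<open>t\<close> makes it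
    applicable.\<close>
  have bdd: "bdd_above (A t)" if "t \<le> b" for t
  proof (rule bdd_aboveI[of _ B])
    fix x assume "x \<in> A t"
    then obtain y where "y \<in> A b" "y = x + \<bar>\<nu> b - \<nu> t\<bar>" using extend \<open>t \<le> b\<close> by blast
    then show "x \<le> B" using B by (auto simp: A_def) (smt (verit, best))
  qed
  fix s t assume st: "a \<le> s" "s \<le> t" "t \<le> b"
  have "is_partition a s 1 (\<lambda>k. if k = 0 then a else s)"
    using st by (simp add: is_partition_def)
  then have ne: "A s \<noteq> {}" by (auto simp: A_def)
  have "x + \<bar>\<nu> t - \<nu> s\<bar> \<le> V t" if "x \<in> A s" for x
    using extend[OF that \<open>s \<le> t\<close>] cSup_upper[OF _ bdd[OF \<open>t \<le> b\<close>]] by (auto simp: V_def)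
  then have "V s \<le> V t - \<bar>\<nu> t - \<nu> s\<bar>"
    unfolding V_def[of s] by (intro cSup_least[OF ne]) (simp add: le_diff_eq)
  then show "\<bar>\<nu> t - \<nu> s\<bar> \<le> V t - V s" by simp
qed

text \<open>Jordan decomposition: \<open>\<nu>\<close> is the difference of the monotone functions
  \<open>V\<close> and \<open>V - \<nu>\<close>.\<close>

lemma finite_variation_on_integrable:
  assumes "finite_variation_on a b \<nu>"
  shows "\<nu> integrable_on {a..b}"
proof -
  obtain V where V: "\<And>s t. a \<le> s \<Longrightarrow> s \<le> t \<Longrightarrow> t \<le> b \<Longrightarrow> \<bar>\<nu> t - \<nu> s\<bar> \<le> V t - V s"
    using finite_variation_on_control[OF assms] by blast
  have "mono_on {a..b} V" "mono_on {a..b} (\<lambda>t. V t - \<nu> t)"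
    by (rule mono_onI, use V in \<open>fastforce simp: abs_le_iff\<close>)+
  then have "(\<lambda>t. V t - (V t - \<nu> t)) integrable_on {a..b}"
    by (intro integrable_diff integrable_on_mono_on)
  then show ?thesis by simp
qed

section \<open>Partitions, uniqueness of the Stieltjes integral, and integration by parts\<close>

lemma is_partition_mem:
  assumes "is_partition a b N t" "k \<le> N"
  shows "a \<le> t k \<and> t k \<le> b"
proof -
  have "t i \<le> t j" if "i \<le> j" "j \<le> N" for i j
    using that
  proof (induction j rule: dec_induct)
    case (step n)
    then have "t n \<le> t (Suc n)" using assms(1) by (simp add: is_partition_def)
    with step show ?case by simp
  qed simp
  then show ?thesis using assms by (metis is_partition_def le0 order_refl)
qed

lemma is_partition_telescope:
  fixes h :: "real \<Rightarrow> real"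
  assumes "is_partition a b N t"
  shows "(\<Sum>k<N. h (t (Suc k)) - h (t k)) = h b - h a"
  using sum_lessThan_telescope[of "\<lambda>k. h (t k)" N] assms by (simp add: is_partition_def)

text \<open>This is what gives the definite description in \<open>stieltjes_integral\<close> its
  meaning. A single partition that is fine enough for both limits puts one Riemann sum within half
  their distance of each. The condition \<open>a \<le> b\<close> guarantees that partitions exist at
  all.\<close>

lemma has_stieltjes_integral_unique:
  assumes "has_stieltjes_integral f \<nu> a b L" "has_stieltjes_integral f \<nu> a b M" "a \<le> b"
  shows "L = M"
proof (rule ccontr)
  assume "L \<noteq> M"
  then have e: "\<bar>L - M\<bar> / 2 > 0" by simp
  obtain c where c: "c > 0" "\<And>N t \<xi>. is_partition a b N t \<and> (\<forall>k<N. t k \<le> \<xi> k \<and> \<xi> k \<le> t (Suc k) \<and> t (Suc k) - t k < c)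
        \<Longrightarrow> \<bar>(\<Sum>k<N. f (\<xi> k) * (\<nu> (t (Suc k)) - \<nu> (t k))) - L\<bar> < \<bar>L - M\<bar> / 2"
    using assms(1)[unfolded has_stieltjes_integral_def, rule_format, OF e] by blast
  obtain d where d: "d > 0" "\<And>N t \<xi>. is_partition a b N t \<and> (\<forall>k<N. t k \<le> \<xi> k \<and> \<xi> k \<le> t (Suc k) \<and> t (Suc k) - t k < d)
        \<Longrightarrow> \<bar>(\<Sum>k<N. f (\<xi> k) * (\<nu> (t (Suc k)) - \<nu> (t k))) - M\<bar> < \<bar>L - M\<bar> / 2"
    using assms(2)[unfolded has_stieltjes_integral_def, rule_format, OF e] by blast
  define m where "m = min c d"
  have m: "m > 0" "m \<le> c" "m \<le> d" using c(1) d(1) by (auto simp: m_def)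
  obtain N :: nat where N: "(b - a) / m < real N" using reals_Archimedean2 by blast
  have Npos: "real N > 0" using N m(1) \<open>a \<le> b\<close> by (smt (verit) divide_nonneg_pos)
  have small: "(b - a) / N < m" using N m(1) Npos by (simp only: pos_divide_less_eq mult.commute)
  \<comment> \<open>A uniform partition with left endpoints as tags; its mesh is below
    \<open>m\<close> by the choice of \<open>N\<close>.\<close>
  define t where "t k = a + real k * ((b - a) / N)" for k
  have step: "t (Suc k) - t k = (b - a) / N" for k by (simp only: t_def of_nat_Suc distrib_right)
  have nonneg: "(b - a) / N \<ge> 0" using \<open>a \<le> b\<close> by simp
  have part: "is_partition a b N t"
    unfolding is_partition_def
  proof (intro conjI allI impI)
    show "t k \<le> t (Suc k)" for k using step[of k] nonneg by linarith
    show "t 0 = a" "t N = b" using Npos by (simp_all add: t_def)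
  qed
  have fine: "t k \<le> t k \<and> t k \<le> t (Suc k) \<and> t (Suc k) - t k < \<eta>" if "m \<le> \<eta>" for k \<eta>
    using step[of k] nonneg small that by linarith
  define S where "S = (\<Sum>k<N. f (t k) * (\<nu> (t (Suc k)) - \<nu> (t k)))"
  have "\<bar>S - L\<bar> < \<bar>L - M\<bar> / 2" unfolding S_def using fine[OF m(2)] part by (intro c(2)) blast
  moreover have "\<bar>S - M\<bar> < \<bar>L - M\<bar> / 2" unfolding S_def using fine[OF m(3)] part by (intro d(2)) blast
  moreover have "\<bar>L - M\<bar> \<le> \<bar>S - L\<bar> + \<bar>S - M\<bar>" by linarith
  ultimately show False by simp
qed

lemma stieltjes_integral_eqI:
  assumes "has_stieltjes_integral f \<nu> a b L" "a \<le> b"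
  shows "stieltjes_integral f \<nu> a b = L"
  unfolding stieltjes_integral_def
  using assms has_stieltjes_integral_unique by (blast intro: the_equality)

text \<open>All Riemann sums of the constant 1 telescope to the same value, so any mesh will do.
  Together with the mass \<open>\<nu> 0\<close> at time 0 this makes the terminal value a weak*
  continuous functional.\<close>

lemma stieltjes_pairing_const:
  assumes "0 \<le> T"
  shows "stieltjes_pairing T \<nu> (\<lambda>_. 1) = \<nu> T"
proof -
  have "has_stieltjes_integral (\<lambda>_. 1) \<nu> 0 T (\<nu> T - \<nu> 0)"
    unfolding has_stieltjes_integral_def
    by (auto simp: is_partition_telescope intro: exI[of _ 1])
  from stieltjes_integral_eqI[OF this assms] show ?thesis
    by (simp add: stieltjes_pairing_def)
qed

text \<open>Integration by parts, with the boundary term at \<open>a\<close> vanishing because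
  \<open>f a = 0\<close>. Since \<open>g\<close> lies between 0 and 1, \<open>f\<close> is Lipschitz
  with constant 1, so the error on each partition interval is at most its length times the variation
  of \<open>\<nu>\<close> over it.\<close>

lemma has_stieltjes_integral_primitive:
  fixes g :: "real \<Rightarrow> real"
  assumes \<nu>: "finite_variation_on a b \<nu>"
    and g: "g integrable_on {a..b}" "\<And>s. 0 \<le> g s \<and> g s \<le> 1"
    and \<nu>g: "(\<lambda>s. \<nu> s * g s) integrable_on {a..b}" and "a \<le> b"
  defines "f \<equiv> \<lambda>s. integral {a..s} g"
  shows "has_stieltjes_integral f \<nu> a b (f b * \<nu> b - integral {a..b} (\<lambda>s. \<nu> s * g s))"
proof -
  obtain V where V: "\<And>s t. a \<le> s \<Longrightarrow> s \<le> t \<Longrightarrow> t \<le> b \<Longrightarrow> \<bar>\<nu> t - \<nu> s\<bar> \<le> V t - V s"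
    using finite_variation_on_control[OF \<nu>] by blast
  \<comment> \<open>The candidate for the indefinite Stieltjes integral: its increment over a
    partition interval is compared with the corresponding Riemann term.\<close>
  define h where "h s = f s * \<nu> s - integral {a..s} (\<lambda>r. \<nu> r * g r)" for s
  \<comment> \<open>Freezing \<open>\<nu>\<close> at a constant \<open>c\<close> in the integral of
    \<open>\<nu> * g\<close> costs at most the oscillation \<open>W\<close> times the
    length.\<close>
  have piece: "\<bar>c * (f t - f s) - (integral {a..t} (\<lambda>r. \<nu> r * g r) - integral {a..s} (\<lambda>r. \<nu> r * g r))\<bar>
        \<le> W * (t - s)"
    if "a \<le> s" "s \<le> t" "t \<le> b" and W: "\<And>r. s \<le> r \<Longrightarrow> r \<le> t \<Longrightarrow> \<bar>c - \<nu> r\<bar> \<le> W" for s t c W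
  proof -
    have i1: "g integrable_on {s..t}" "(\<lambda>r. \<nu> r * g r) integrable_on {s..t}"
      using that by (auto intro: integrable_on_subinterval[OF g(1)] integrable_on_subinterval[OF \<nu>g])
    have i2: "g integrable_on {a..t}" "(\<lambda>r. \<nu> r * g r) integrable_on {a..t}"
      using that by (auto intro: integrable_on_subinterval[OF g(1)] integrable_on_subinterval[OF \<nu>g])
    have "f t - f s = integral {s..t} g"
      using Henstock_Kurzweil_Integration.integral_combine[OF \<open>a \<le> s\<close> \<open>s \<le> t\<close> i2(1)] by (simp add: f_def)
    moreover have "integral {a..t} (\<lambda>r. \<nu> r * g r) - integral {a..s} (\<lambda>r. \<nu> r * g r) = integral {s..t} (\<lambda>r. \<nu> r * g r)"
      using Henstock_Kurzweil_Integration.integral_combine[OF \<open>a \<le> s\<close> \<open>s \<le> t\<close> i2(2)] by simp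
    moreover have "c * integral {s..t} g - integral {s..t} (\<lambda>r. \<nu> r * g r)
        = integral {s..t} (\<lambda>r. c * g r - \<nu> r * g r)"
      using Henstock_Kurzweil_Integration.integral_diff[OF integrable_on_cmult_left[OF i1(1), of c] i1(2)] by simp
    moreover have "norm (integral {s..t} (\<lambda>r. c * g r - \<nu> r * g r)) \<le> integral {s..t} (\<lambda>r. W)"
    proof (rule integral_norm_bound_integral)
      show "(\<lambda>r. c * g r - \<nu> r * g r) integrable_on {s..t}"
        using integrable_diff[OF integrable_on_cmult_left[OF i1(1), of c] i1(2)] by simp
      fix r assume "r \<in> {s..t}"
      then have "\<bar>c - \<nu> r\<bar> * g r \<le> W * 1" using W g(2)[of r] by (intro mult_mono) (auto intro: order_trans[OF abs_ge_zero])
      moreover have "norm (c * g r - \<nu> r * g r) = \<bar>c - \<nu> r\<bar> * g r"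
        using g(2)[of r] by (simp add: left_diff_distrib[symmetric] abs_mult)
      ultimately show "norm (c * g r - \<nu> r * g r) \<le> W" by simp
    qed (simp add: integrable_const_ivl)
    ultimately show ?thesis using that by (simp add: mult.commute)
  qed
  \<comment> \<open>The interval is split at the tag: \<open>\<nu>\<close> is frozen at its value at
    \<open>t\<close> to the right of \<open>\<xi>\<close> and at its value at \<open>s\<close> to
    the left. The terms regroup by summation by parts, and the two errors add up along the
    length.\<close>
  have interval: "\<bar>f \<xi> * (\<nu> t - \<nu> s) - (h t - h s)\<bar> \<le> (V t - V s) * (t - s)"
    if "a \<le> s" "s \<le> \<xi>" "\<xi> \<le> t" "t \<le> b" for s \<xi> t
  proof -
    have "\<bar>\<nu> t - \<nu> r\<bar> \<le> V t - V s" if "\<xi> \<le> r" "r \<le> t" for r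
      using V[of r t] V[of s r] that \<open>a \<le> s\<close> \<open>s \<le> \<xi>\<close> \<open>t \<le> b\<close> by linarith
    from piece[OF _ \<open>\<xi> \<le> t\<close> \<open>t \<le> b\<close> this]
    have 1: "\<bar>\<nu> t * (f t - f \<xi>) - (integral {a..t} (\<lambda>r. \<nu> r * g r) - integral {a..\<xi>} (\<lambda>r. \<nu> r * g r))\<bar>
        \<le> (V t - V s) * (t - \<xi>)" using that by simp
    have "\<bar>\<nu> s - \<nu> r\<bar> \<le> V t - V s" if "s \<le> r" "r \<le> \<xi>" for r
      using V[of r t] V[of s r] that \<open>a \<le> s\<close> \<open>\<xi> \<le> t\<close> \<open>t \<le> b\<close> by linarith
    from piece[OF \<open>a \<le> s\<close> \<open>s \<le> \<xi>\<close> _ this]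
    have 2: "\<bar>\<nu> s * (f \<xi> - f s) - (integral {a..\<xi>} (\<lambda>r. \<nu> r * g r) - integral {a..s} (\<lambda>r. \<nu> r * g r))\<bar>
        \<le> (V t - V s) * (\<xi> - s)" using that by simp
    have "(V t - V s) * (t - \<xi>) + (V t - V s) * (\<xi> - s) = (V t - V s) * (t - s)"
      by (simp add: algebra_simps)
    moreover have "f \<xi> * (\<nu> t - \<nu> s) - (h t - h s) =
       - (\<nu> t * (f t - f \<xi>) - (integral {a..t} (\<lambda>r. \<nu> r * g r) - integral {a..\<xi>} (\<lambda>r. \<nu> r * g r)))
       - (\<nu> s * (f \<xi> - f s) - (integral {a..\<xi>} (\<lambda>r. \<nu> r * g r) - integral {a..s} (\<lambda>r. \<nu> r * g r)))"
      by (simp add: h_def algebra_simps)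
    ultimately show ?thesis using 1 2 by linarith
  qed
  have hab: "h b - h a = f b * \<nu> b - integral {a..b} (\<lambda>s. \<nu> s * g s)" by (simp add: h_def f_def)
  have Vab: "V b - V a \<ge> 0" using V[of a b] \<open>a \<le> b\<close> by linarith
  show ?thesis
    unfolding has_stieltjes_integral_def hab[symmetric]
  proof (intro allI impI)
    fix e :: real assume "e > 0"
    \<comment> \<open>The added 1 keeps the denominator positive when the variation is zero.\<close>
    define \<delta> where "\<delta> = e / (V b - V a + 1)"
    have "\<delta> > 0" and small: "(V b - V a) * \<delta> < e"
      using Vab \<open>e > 0\<close> by (auto simp: \<delta>_def field_simps)
    moreover have "\<bar>(\<Sum>k<N. f (\<xi> k) * (\<nu> (t (Suc k)) - \<nu> (t k))) - (h b - h a)\<bar> < e"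
      if p: "is_partition a b N t" and
        q: "\<forall>k<N. t k \<le> \<xi> k \<and> \<xi> k \<le> t (Suc k) \<and> t (Suc k) - t k < \<delta>" for N t \<xi>
    proof -
      have "\<bar>(\<Sum>k<N. f (\<xi> k) * (\<nu> (t (Suc k)) - \<nu> (t k))) - (h b - h a)\<bar>
        = \<bar>\<Sum>k<N. f (\<xi> k) * (\<nu> (t (Suc k)) - \<nu> (t k)) - (h (t (Suc k)) - h (t k))\<bar>"
        unfolding is_partition_telescope[OF p, of h, symmetric] by (simp only: sum_subtractf)
      also have "\<dots> \<le> (\<Sum>k<N. (V (t (Suc k)) - V (t k)) * \<delta>)"
      proof (rule order_trans[OF sum_abs], rule sum_mono)
        fix k assume "k \<in> {..<N}"
        then have k: "a \<le> t k" "t (Suc k) \<le> b" "t k \<le> \<xi> k" "\<xi> k \<le> t (Suc k)" "t (Suc k) - t k < \<delta>"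
          using is_partition_mem[OF p, of k] is_partition_mem[OF p, of "Suc k"] q by auto
        then have "V (t (Suc k)) - V (t k) \<ge> 0" using V[of "t k" "t (Suc k)"] by linarith
        then show "\<bar>f (\<xi> k) * (\<nu> (t (Suc k)) - \<nu> (t k)) - (h (t (Suc k)) - h (t k))\<bar>
            \<le> (V (t (Suc k)) - V (t k)) * \<delta>"
          using interval[OF k(1,3,4,2)] k(5) by (smt (verit) mult_left_mono)
      qed
      also have "\<dots> = (V b - V a) * \<delta>"
        by (simp only: sum_distrib_right[symmetric] is_partition_telescope[OF p])
      finally show ?thesis using small by linarith
    qed
    ultimately show "\<exists>\<delta>>0. \<forall>N t \<xi>. is_partition a b N t \<and>
        (\<forall>k<N. t k \<le> \<xi> k \<and> \<xi> k \<le> t (Suc k) \<and> t (Suc k) - t k < \<delta>) \<longrightarrow>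
        \<bar>(\<Sum>k<N. f (\<xi> k) * (\<nu> (t (Suc k)) - \<nu> (t k))) - (h b - h a)\<bar> < e"
      by blast
  qed
qed

text \<open>The indicator of an interval has a continuous primitive \<open>f\<close>, which is an
  admissible test function. Integration by parts writes the integral over the interval as a
  combination of the pairings with \<open>f\<close> and with the constant 1, and both
  converge.\<close>

lemma weak_star_converges_integral:
  assumes conv: "weak_star_converges T \<nu> \<nu>\<^sub>0" and "0 \<le> u" "u \<le> v" "v \<le> T"
    and \<nu>: "\<And>n. finite_variation_on 0 T (\<nu> n)" "finite_variation_on 0 T \<nu>\<^sub>0"
  shows "(\<lambda>n. integral {u..v} (\<nu> n)) \<longlonglongrightarrow> integral {u..v} \<nu>\<^sub>0"
proof -
  define g :: "real \<Rightarrow> real" where "g s = (if s \<in> {u..v} then 1 else 0)" for s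
  define f where "f s = integral {0..s} g" for s
  have int: "{u..v} \<inter> {0..T} = {u..v}" using assms by auto
  have g: "g integrable_on {0..T}"
    unfolding g_def integrable_restrict_Int int by (rule integrable_const_ivl)
  have f: "continuous_on {0..T} f"
    unfolding f_def by (rule indefinite_integral_continuous_1[OF g])
  have pairing: "stieltjes_pairing T \<mu> f = f T * stieltjes_pairing T \<mu> (\<lambda>_. 1) - integral {u..v} \<mu>"
    if \<mu>: "finite_variation_on 0 T \<mu>" for \<mu>
  proof -
    have eq: "(\<lambda>s. \<mu> s * g s) = (\<lambda>s. if s \<in> {u..v} then \<mu> s else 0)" by (auto simp: g_def)
    have "\<mu> integrable_on {u..v}"
      using assms by (auto intro: integrable_on_subinterval[OF finite_variation_on_integrable[OF \<mu>]])
    then have "(\<lambda>s. \<mu> s * g s) integrable_on {0..T}"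
      unfolding eq integrable_restrict_Int int .
    moreover have "0 \<le> g s \<and> g s \<le> 1" for s by (simp add: g_def)
    moreover have "0 \<le> T" using assms by simp
    ultimately have "has_stieltjes_integral f \<mu> 0 T (f T * \<mu> T - integral {0..T} (\<lambda>s. \<mu> s * g s))"
      unfolding f_def[abs_def] by (intro has_stieltjes_integral_primitive[OF \<mu> g])
    from stieltjes_integral_eqI[OF this]
    have "stieltjes_integral f \<mu> 0 T = f T * \<mu> T - integral {u..v} \<mu>"
      using assms by (simp only: eq Henstock_Kurzweil_Integration.integral_restrict_Int int)
    then show ?thesis using assms by (simp add: stieltjes_pairing_def[of _ _ f] stieltjes_pairing_const f_def)
  qed
  have "(\<lambda>n. f T * stieltjes_pairing T (\<nu> n) (\<lambda>_. 1) - stieltjes_pairing T (\<nu> n) f)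
      \<longlonglongrightarrow> f T * stieltjes_pairing T \<nu>\<^sub>0 (\<lambda>_. 1) - stieltjes_pairing T \<nu>\<^sub>0 f"
    using conv f unfolding weak_star_converges_def by (intro tendsto_intros) auto
  then show ?thesis using \<nu> by (simp add: pairing)
qed

section \<open>S-limits of constant sequences\<close>

text \<open>Weak* convergence does not control values at interior points, but it does control
  averages over intervals. On a short interval to the right of \<open>t\<close>, both functions stay
  close to their values at \<open>t\<close> by right continuity, so comparing averages compares
  these values. At \<open>t = T\<close> there is no room to the right, and convergence of terminal
  values takes over.\<close>

lemma S_converges_real_const_imp_eq:
  assumes conv: "S_converges_real T (\<lambda>n. y) x" and cad: "cadlag_on {0..T} y" "cadlag_on {0..T} x"
    and t: "t \<in> {0..T}"
  shows "x t = y t"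
proof -
  have "\<bar>x t - y t\<bar> \<le> 4 * \<epsilon>" if "\<epsilon> > 0" for \<epsilon>
  proof -
    obtain \<nu> \<nu>\<^sub>0 where \<nu>: "\<And>n. finite_variation_on 0 T (\<nu> n)" "finite_variation_on 0 T \<nu>\<^sub>0"
      and y: "\<And>n s. s \<in> {0..T} \<Longrightarrow> \<bar>y s - \<nu> n s\<bar> \<le> \<epsilon>" and x: "\<And>s. s \<in> {0..T} \<Longrightarrow> \<bar>x s - \<nu>\<^sub>0 s\<bar> \<le> \<epsilon>"
      and w: "weak_star_converges T \<nu> \<nu>\<^sub>0"
      using conv \<open>\<epsilon> > 0\<close> unfolding S_converges_real_def by metis
    show ?thesis
    proof (cases "t = T")
      case True
      have "(\<lambda>n. \<nu> n T) \<longlonglongrightarrow> \<nu>\<^sub>0 T"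
        using w t unfolding weak_star_converges_def
        by (auto simp: stieltjes_pairing_const dest!: spec[where x="\<lambda>_. 1"])
      then have "(\<lambda>n. \<bar>y T - \<nu> n T\<bar>) \<longlonglongrightarrow> \<bar>y T - \<nu>\<^sub>0 T\<bar>" by (intro tendsto_intros)
      then have "\<bar>y T - \<nu>\<^sub>0 T\<bar> \<le> \<epsilon>" by (rule LIMSEQ_le_const2) (use y t in auto)
      then show ?thesis using True x[of T] t \<open>\<epsilon> > 0\<close> by auto
    next
      case False
      then have tT: "0 \<le> t" "t < T" using t by auto
      have right: "\<exists>d>0. \<forall>s. t \<le> s \<and> s \<le> t + d \<and> s \<le> T \<longrightarrow> \<bar>z s - z t\<bar> < \<epsilon>"
        if "cadlag_on {0..T} z" for z :: "real \<Rightarrow> real"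
      proof -
        have "(z \<longlongrightarrow> z t) (at t within {0..T} \<inter> {t<..})" using that t by (simp add: cadlag_on_def)
        then obtain d where "d > 0" and d: "\<And>s. s \<in> {0..T} \<inter> {t<..} \<Longrightarrow> s \<noteq> t \<Longrightarrow> dist s t < d \<Longrightarrow> dist (z s) (z t) < \<epsilon>"
          using \<open>\<epsilon> > 0\<close> unfolding tendsto_iff eventually_at by metis
        have "\<bar>z s - z t\<bar> < \<epsilon>" if "t \<le> s" "s \<le> t + d/2" "s \<le> T" for s
          using d[of s] that tT \<open>d > 0\<close> \<open>\<epsilon> > 0\<close> by (cases "s = t") (auto simp: dist_real_def)
        then show ?thesis using \<open>d > 0\<close> by (intro exI[of _ "d/2"]) auto
      qed
      obtain d1 d2 where d: "d1 > 0" "d2 > 0"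
        and dx: "\<And>s. t \<le> s \<Longrightarrow> s \<le> t + d1 \<Longrightarrow> s \<le> T \<Longrightarrow> \<bar>x s - x t\<bar> < \<epsilon>"
        and dy: "\<And>s. t \<le> s \<Longrightarrow> s \<le> t + d2 \<Longrightarrow> s \<le> T \<Longrightarrow> \<bar>y s - y t\<bar> < \<epsilon>"
        using right[OF cad(1)] right[OF cad(2)] by blast
      \<comment> \<open>The cap at \<open>T\<close> keeps the averaging interval inside the domain;
        \<open>t < T\<close> gives it positive length.\<close>
      define v where "v = min T (t + min d1 d2)"
      have v: "t < v" "v \<le> T" "v \<le> t + d1" "v \<le> t + d2" using d tT by (auto simp: v_def)
      \<comment> \<open>The tolerance \<open>2 * \<epsilon>\<close> is \<open>\<epsilon>\<close> for
        the approximation by a function of finite variation plus \<open>\<epsilon>\<close> for right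
        continuity. It is used once for \<open>y\<close> and once for \<open>x\<close>, whence the
        factor 4.\<close>
      have avg: "\<bar>integral {t..v} \<mu> - c * (v - t)\<bar> \<le> 2 * \<epsilon> * (v - t)"
        if \<mu>: "finite_variation_on 0 T \<mu>" and c: "\<And>s. t \<le> s \<Longrightarrow> s \<le> v \<Longrightarrow> \<bar>\<mu> s - c\<bar> \<le> 2 * \<epsilon>" for \<mu> c
      proof -
        have "\<mu> integrable_on {t..v}"
          using tT v by (auto intro: integrable_on_subinterval[OF finite_variation_on_integrable[OF \<mu>]])
        note int = this integrable_const_ivl[of c t v]
        have "norm (integral {t..v} (\<lambda>s. \<mu> s - c)) \<le> integral {t..v} (\<lambda>s. 2 * \<epsilon>)"
          using c by (intro integral_norm_bound_integral integrable_diff int integrable_const_ivl) auto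
        moreover have "integral {t..v} (\<lambda>s. \<mu> s - c) = integral {t..v} \<mu> - c * (v - t)"
          using v by (simp add: Henstock_Kurzweil_Integration.integral_diff[OF int])
        moreover have "integral {t..v} (\<lambda>s. 2 * \<epsilon>) = 2 * \<epsilon> * (v - t)" using v by simp
        ultimately show ?thesis by (simp only: real_norm_def)
      qed
      have "\<bar>integral {t..v} (\<nu> n) - y t * (v - t)\<bar> \<le> 2 * \<epsilon> * (v - t)" for n
        using y[of _ n] dy v tT by (intro avg[OF \<nu>(1)]) (smt (verit) atLeastAtMost_iff)
      moreover have "(\<lambda>n. \<bar>integral {t..v} (\<nu> n) - y t * (v - t)\<bar>) \<longlonglongrightarrow> \<bar>integral {t..v} \<nu>\<^sub>0 - y t * (v - t)\<bar>"
        using weak_star_converges_integral[OF w _ _ _ \<nu>] tT v by (intro tendsto_intros) auto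
      ultimately have "\<bar>integral {t..v} \<nu>\<^sub>0 - y t * (v - t)\<bar> \<le> 2 * \<epsilon> * (v - t)"
        by (auto intro: LIMSEQ_le_const2)
      moreover have "\<bar>integral {t..v} \<nu>\<^sub>0 - x t * (v - t)\<bar> \<le> 2 * \<epsilon> * (v - t)"
        using x dx v tT by (intro avg[OF \<nu>(2)]) (smt (verit) atLeastAtMost_iff)
      ultimately have "\<bar>x t * (v - t) - y t * (v - t)\<bar> \<le> 4 * \<epsilon> * (v - t)" by linarith
      then have "\<bar>x t - y t\<bar> * (v - t) \<le> 4 * \<epsilon> * (v - t)"
        using v by (simp add: left_diff_distrib[symmetric] abs_mult)
      then show ?thesis using v by simp
    qed
  qed
  \<comment> \<open>With this choice of \<open>\<epsilon>\<close> the distance is at most half of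
    itself, hence zero.\<close>
  from this[of "\<bar>x t - y t\<bar> / 8"] show ?thesis by (cases "x t = y t") auto
qed

section \<open>Sequential topologies\<close>

text \<open>Every subsequence of a constant sequence is that same sequence, so subsequential
  convergence reduces to \<open>conv\<close> itself.\<close>

lemma t1_space_sequential_topology:
  assumes "\<And>y l. y \<in> X \<Longrightarrow> l \<in> X \<Longrightarrow> conv (\<lambda>_. y) l \<Longrightarrow> l = y"
  shows "t1_space (sequential_topology X conv)"
  unfolding t1_space_closedin_singleton closedin_sequential_topology seq_closed_def
proof (intro ballI conjI allI impI)
  fix y x l assume y: "y \<in> topspace (sequential_topology X conv)"
    and *: "(\<forall>n. x n \<in> {y}) \<and> l \<in> X \<and> subseq_converges conv x l"
  then obtain s where "conv (x \<circ> id \<circ> s) l"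
    unfolding subseq_converges_def by (metis strict_mono_id)
  moreover have "x \<circ> id \<circ> s = (\<lambda>_. y)" using * by auto
  ultimately show "l \<in> {y}" using assms y * by auto
qed simp

text \<open>If infinitely many terms missed an open neighbourhood of \<open>l\<close>, they would
  form a subsequence in its closed complement that still converges subsequentially to
  \<open>l\<close>.\<close>

lemma limitin_sequential_topology:
  assumes "\<And>n. x n \<in> X" "l \<in> X" "subseq_converges conv x l"
  shows "limitin (sequential_topology X conv) x l sequentially"
  unfolding limitin_def
proof (intro conjI allI impI)
  fix U assume U: "openin (sequential_topology X conv) U \<and> l \<in> U"
  show "\<forall>\<^sub>F n in sequentially. x n \<in> U"
  proof (rule ccontr)
    assume "\<not> ?thesis"
    then have "infinite {n. x n \<notin> U}"
      by (simp add: cofinite_eq_sequentially[symmetric] eventually_cofinite)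
    then obtain q :: "nat \<Rightarrow> nat" where q: "strict_mono q" "\<And>n. x (q n) \<notin> U"
      using infinite_enumerate by blast
    then have "\<forall>n. (x \<circ> q) n \<in> X - U" "subseq_converges conv (x \<circ> q) l"
      using assms subseq_converges_subseq by auto
    then show False using U assms(2)
      unfolding openin_sequential_topology seq_closed_def by blast
  qed
qed (use assms in simp)

section \<open>Sequential spaces and their behaviour under products and pullbacks\<close>

definition sequential_space :: "'a topology \<Rightarrow> bool" where
  "sequential_space X \<longleftrightarrow>
     (\<forall>C \<subseteq> topspace X. (\<forall>x l. range x \<subseteq> C \<and> limitin X x l sequentially \<longrightarrow> l \<in> C) \<longrightarrow> closedin X C)"

text \<open>Subsequential convergence implies topological convergence, so a set closed under
  topological limits is \<open>seq_closed\<close>. This replaces the generating relation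
  \<open>conv\<close> by a property of the topology alone, which can be carried over to the product
  with the Euclidean factor.\<close>

lemma sequential_space_sequential_topology: "sequential_space (sequential_topology X conv)"
  unfolding sequential_space_def
proof (intro allI impI)
  fix C assume C: "C \<subseteq> topspace (sequential_topology X conv)"
    and lim: "\<forall>x l. range x \<subseteq> C \<and> limitin (sequential_topology X conv) x l sequentially \<longrightarrow> l \<in> C"
  show "closedin (sequential_topology X conv) C"
    unfolding closedin_sequential_topology seq_closed_def
  proof (intro conjI allI impI)
    fix x l assume *: "(\<forall>n. x n \<in> C) \<and> l \<in> X \<and> subseq_converges conv x l"
    then have "limitin (sequential_topology X conv) x l sequentially"
      using C by (intro limitin_sequential_topology) auto
    then show "l \<in> C" using lim * by blast
  qed (use C in simp)
qed

lemma sequential_space_closedin: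
  fixes X :: "'a topology"
  assumes "sequential_space X" "C \<subseteq> topspace X"
    and "\<And>(x :: nat \<Rightarrow> 'a) l. range x \<subseteq> C \<Longrightarrow> limitin X x l sequentially \<Longrightarrow> l \<in> C"
  shows "closedin X C"
  using assms(1)[unfolded sequential_space_def] assms(2,3) by blast

lemma sequential_space_openin:
  assumes "sequential_space X" "U \<subseteq> topspace X"
    and "\<And>x l. l \<in> U \<Longrightarrow> range x \<subseteq> topspace X - U \<Longrightarrow> \<not> limitin X x l sequentially"
  shows "openin X U"
proof -
  have "closedin X (topspace X - U)"
  proof (rule sequential_space_closedin[OF assms(1)])
    fix x l assume "range x \<subseteq> topspace X - U" "limitin X x l sequentially"
    then show "l \<in> topspace X - U" using assms(3)[of l x] limitin_topspace by fastforce
  qed blast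
  then show ?thesis using assms(2) by (simp add: openin_closedin_eq)
qed

text \<open>Products of sequential spaces need not be sequential; here compactness of closed balls
  in the second factor helps. Around a point outside \<open>C\<close>, first a ball in the vertical
  direction is found, then a neighbourhood in \<open>X\<close> over which the whole closed ball
  avoids \<open>C\<close>.\<close>

lemma sequential_space_prod_euclidean:
  fixes X :: "'a topology"
  assumes X: "sequential_space X"
  shows "sequential_space (prod_topology X (euclidean :: 'b::heine_borel topology))"
  unfolding sequential_space_def
proof (intro allI impI)
  let ?P = "prod_topology X (euclidean :: 'b topology)"
  fix C assume C: "C \<subseteq> topspace ?P"
    and closed: "\<forall>x l. range x \<subseteq> C \<and> limitin ?P x l sequentially \<longrightarrow> l \<in> C"
  have lim: "(a, b) \<in> C"
    if "\<And>n :: nat. (x n, y n) \<in> C" "limitin X x a sequentially" "y \<longlonglongrightarrow> b" for x y a b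
  proof -
    have "limitin ?P (\<lambda>n. (x n, y n)) (a, b) sequentially"
      using that by (simp add: limitin_pairwise o_def)
    moreover have "range (\<lambda>n. (x n, y n)) \<subseteq> C" using that by blast
    ultimately show ?thesis using closed by blast
  qed
  define U where "U = topspace ?P - C"
  have "openin ?P U"
    unfolding openin_prod_topology_alt
  proof (intro allI impI)
    fix a b assume ab: "(a, b) \<in> U"
    then have a: "a \<in> topspace X" "(a, b) \<notin> C" by (auto simp: U_def)
    \<comment> \<open>Otherwise points of \<open>C\<close> on the vertical line through
      \<open>a\<close> would converge to \<open>(a, b)\<close>, with distances below
      \<open>1/(n+1)\<close>.\<close>
    obtain e where "e > 0" and e: "\<And>v. v \<in> cball b e \<Longrightarrow> (a, v) \<notin> C"
    proof (rule ccontr)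
      assume not: "\<not> thesis"
      have "\<exists>v. dist b v \<le> inverse (real (Suc n)) \<and> (a, v) \<in> C" for n
      proof (rule ccontr)
        assume "\<not> ?thesis"
        then have thesis by (intro that[of "inverse (real (Suc n))"]) auto
        with not show False ..
      qed
      then obtain y where y: "\<And>n. dist b (y n) \<le> inverse (real (Suc n))" "\<And>n. (a, y n) \<in> C"
        by metis
      have "(\<lambda>n. dist (y n) b) \<longlonglongrightarrow> 0"
        by (rule tendsto_sandwich[OF _ _ tendsto_const LIMSEQ_inverse_real_of_nat])
          (use y(1) in \<open>simp_all add: dist_commute\<close>)
      then have "y \<longlonglongrightarrow> b" by (simp add: tendsto_dist_iff[of y])
      then have "(a, b) \<in> C" using lim[of "\<lambda>_. a" y, OF y(2)] a by simp
      then show False using a by simp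
    qed
    define W where "W = {x \<in> topspace X. \<forall>v\<in>cball b e. (x, v) \<notin> C}"
    \<comment> \<open>If points outside \<open>W\<close> converged to a point \<open>l\<close> of
      \<open>W\<close>, each would carry a witness in the compact ball; along a subsequence the
      witnesses converge to some \<open>v\<close> in the ball, which forces \<open>(l, v)\<close>
      into \<open>C\<close>.\<close>
    have "openin X W"
    proof (rule sequential_space_openin[OF X])
      fix x :: "nat \<Rightarrow> 'a" and l assume "l \<in> W" and x: "range x \<subseteq> topspace X - W"
      then have "\<exists>v\<in>cball b e. (x n, v) \<in> C" for n by (auto simp: W_def)
      then obtain y where y: "\<And>n. y n \<in> cball b e" "\<And>n. (x n, y n) \<in> C" by metis
      obtain v and r :: "nat \<Rightarrow> nat" where v: "v \<in> cball b e" and r: "strict_mono r" "(y \<circ> r) \<longlonglongrightarrow> v"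
        using compact_cball[of b e] y(1) unfolding compact_def by blast
      show "\<not> limitin X x l sequentially"
      proof
        assume "limitin X x l sequentially"
        then have "limitin X (x \<circ> r) l sequentially" using r by (simp add: limitin_subsequence)
        then have "(l, v) \<in> C" using lim[of "x \<circ> r" "y \<circ> r"] y r(2) by simp
        then show False using \<open>l \<in> W\<close> v by (auto simp: W_def)
      qed
    qed (auto simp: W_def)
    moreover have "W \<times> ball b e \<subseteq> U" by (auto simp: W_def U_def)
    moreover have "a \<in> W" using a e by (auto simp: W_def)
    ultimately show "\<exists>W V. openin X W \<and> openin euclidean V \<and> a \<in> W \<and> b \<in> V \<and> W \<times> V \<subseteq> U"
      using \<open>e > 0\<close> by (intro exI[of _ W] exI[of _ "ball b e"] conjI) auto
  qed
  then show "closedin ?P C" using C by (simp add: U_def closedin_def)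
qed

lemma sequential_space_pullback_topology:
  assumes f: "bij_betw f A (topspace X)" and X: "sequential_space X"
  shows "sequential_space (pullback_topology A f X)"
  unfolding sequential_space_def
proof (intro allI impI)
  let ?P = "pullback_topology A f X"
  have fA: "f ` A = topspace X" and inj: "inj_on f A" using f by (simp_all add: bij_betw_def)
  have top: "topspace ?P = A" unfolding topspace_pullback_topology fA[symmetric] by blast
  fix C assume CP: "C \<subseteq> topspace ?P"
    and lim: "\<forall>x l. range x \<subseteq> C \<and> limitin ?P x l sequentially \<longrightarrow> l \<in> C"
  have C: "C \<subseteq> A" using CP unfolding top .
  have "closedin X (f ` C)"
  proof (rule sequential_space_closedin[OF X])
    show "f ` C \<subseteq> topspace X" using image_mono[OF C, of f] unfolding fA .
    fix x l assume *: "range x \<subseteq> f ` C" "limitin X x l sequentially"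
    have "\<exists>c. c \<in> C \<and> f c = x n" for n
    proof -
      have "x n \<in> f ` C" using *(1) rangeI by (rule subsetD)
      then show ?thesis by (metis imageE)
    qed
    then obtain z where z: "\<And>n. z n \<in> C" "\<And>n. f (z n) = x n" by metis
    have "l \<in> f ` A" unfolding fA using *(2) by (rule limitin_topspace)
    then obtain m where m: "m \<in> A" "f m = l" by blast
    have "limitin ?P z m sequentially"
      unfolding limitin_def
    proof (intro conjI allI impI)
      fix U assume U: "openin ?P U \<and> m \<in> U"
      then obtain V where V: "openin X V" "U = f -` V \<inter> A"
        unfolding openin_pullback_topology by blast
      have "l \<in> V" using U V(2) m(2) by blast
      then have ev: "\<forall>\<^sub>F n in sequentially. x n \<in> V" using *(2) V(1) by (simp add: limitin_def)
      have "z n \<in> U" if "x n \<in> V" for n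
        using that z[of n] C V(2) by auto
      then show "\<forall>\<^sub>F n in sequentially. z n \<in> U"
        by (rule eventually_mono[OF ev])
    next
      show "m \<in> topspace ?P" using m(1) unfolding top .
    qed
    then have "m \<in> C" using lim z(1) by blast
    then show "l \<in> f ` C" using m(2) by blast
  qed
  then have "openin X (topspace X - f ` C)" by (simp add: closedin_def)
  moreover have "A - C = f -` (topspace X - f ` C) \<inter> A"
  proof (intro set_eqI iffI)
    fix w assume "w \<in> A - C"
    then show "w \<in> f -` (topspace X - f ` C) \<inter> A"
      unfolding fA[symmetric] using C inj by (simp add: inj_on_image_mem_iff)
  qed auto
  ultimately have "openin ?P (A - C)"
    unfolding openin_pullback_topology by blast
  then show "closedin ?P C" unfolding closedin_def top using C by blast
qed

lemma t1_space_pullback_topology: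
  assumes f: "inj_on f A" and X: "t1_space X"
  shows "t1_space (pullback_topology A f X)"
  unfolding t1_space_def
proof (intro ballI impI)
  fix x y assume "x \<in> topspace (pullback_topology A f X)" "y \<in> topspace (pullback_topology A f X)" "x \<noteq> y"
  then have *: "x \<in> A" "y \<in> A" "f x \<in> topspace X" "f y \<in> topspace X" "f x \<noteq> f y"
    using f by (auto simp: topspace_pullback_topology dest: inj_onD)
  then obtain U where "openin X U" "f x \<in> U" "f y \<notin> U" using X unfolding t1_space_def by meson
  then show "\<exists>U. openin (pullback_topology A f X) U \<and> x \<in> U \<and> y \<notin> U"
    using * by (intro exI[of _ "f -` U \<inter> A"]) (auto simp: openin_pullback_topology)
qed

section \<open>Topologies with the same compact sets\<close>

lemma closedin_limitin_same_compact:
  assumes X: "Hausdorff_space X" and Y: "t1_space Y"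
    and compact: "\<And>K. compactin Y K \<Longrightarrow> compactin X K"
    and C: "closedin X C" "C \<subseteq> topspace Y" and x: "range x \<subseteq> C" and lim: "limitin Y x l sequentially"
  shows "l \<in> C"
proof (rule ccontr)
  assume l: "l \<notin> C"
  have D: "compactin X D" if "D \<subseteq> range x" for D
  proof -
    have "compactin X (insert l D)"
      using compactin_sequence_with_limit[OF lim that] that x C by (intro compact) blast
    then have "compactin X (C \<inter> insert l D)" by (rule closed_Int_compactin[OF C(1)])
    moreover have "C \<inter> insert l D = D" using l that x by blast
    ultimately show ?thesis by simp
  qed
  show False
  proof (cases "finite (range x)")
    case True
    \<comment> \<open>Some value \<open>y\<close> recurs infinitely often, but \<open>y\<close> lies
      in \<open>C\<close> and \<open>l\<close> does not, so a neighbourhood of \<open>l\<close> in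
      \<open>Y\<close> excludes \<open>y\<close>.\<close>
    then obtain y where "y \<in> range x" and y: "infinite {n. x n = y}"
      using pigeonhole_infinite[OF infinite_UNIV_nat True] by auto
    have "l \<in> topspace Y" using lim by (rule limitin_topspace)
    moreover have "y \<noteq> l" "y \<in> topspace Y" using \<open>y \<in> range x\<close> x l C by auto
    ultimately obtain U where U: "openin Y U" "l \<in> U" "y \<notin> U" using Y unfolding t1_space_def by metis
    then have "finite {n. x n \<notin> U}"
      using lim by (simp add: limitin_def cofinite_eq_sequentially[symmetric] eventually_cofinite)
    moreover have "{n. x n = y} \<subseteq> {n. x n \<notin> U}" using U by blast
    ultimately show False using y finite_subset by blast
  next
    case False
    then obtain p where p: "p \<in> X derived_set_of range x"
      using compactin_imp_Bolzano_Weierstrass[OF D[OF order_refl], of "range x"] by auto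
    \<comment> \<open>Removing \<open>p\<close> does not affect accumulation at \<open>p\<close>.
      The remaining set is compact by \<open>D\<close>, hence closed, and would have to contain
      \<open>p\<close>.\<close>
    have "p \<in> X derived_set_of (range x - {p})"
      using p by (fastforce simp: in_derived_set_of)
    moreover have "closedin X (range x - {p})"
      by (rule compactin_imp_closedin[OF X D]) blast
    ultimately show False by (auto simp: closedin_contains_derived_set)
  qed
qed

lemma openin_same_compact:
  assumes "Hausdorff_space X" "t1_space Y" "sequential_space Y" "topspace X = topspace Y"
    and "\<And>K. compactin Y K \<Longrightarrow> compactin X K" and U: "openin X U"
  shows "openin Y U"
proof (rule sequential_space_openin)
  show "U \<subseteq> topspace Y" using openin_subset[OF U] assms by simp
  fix x :: "nat \<Rightarrow> 'a" and l assume "l \<in> U" "range x \<subseteq> topspace Y - U"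
  moreover have "closedin X (topspace Y - U)" using U assms(4) by (metis openin_closedin_eq)
  ultimately show "\<not> limitin Y x l sequentially"
    using closedin_limitin_same_compact[OF assms(1,2,5), of "topspace Y - U" x l] by blast
qed fact

section \<open>The S-topology\<close>

text \<open>The passage to a subset \<open>K\<close> is there because S-convergence on the half-line
  is tested on bounded intervals.\<close>

lemma cadlag_on_component:
  fixes z :: "ereal \<Rightarrow> real ^ 'd"
  assumes "cadlag_on J (\<lambda>t. z (ereal t))" "K \<subseteq> J"
  shows "cadlag_on K (\<lambda>t. z (ereal t) $ i)"
  unfolding cadlag_on_def
proof (intro ballI conjI)
  fix t assume "t \<in> K"
  then have t: "t \<in> J" using assms by blast
  have sub: "((\<lambda>t. z (ereal t) $ i) \<longlongrightarrow> l $ i) (at t within K \<inter> A)"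
    if "((\<lambda>t. z (ereal t)) \<longlongrightarrow> l) (at t within J \<inter> A)" for l A
    using tendsto_vec_nth[OF tendsto_within_subset[OF that]] assms(2) by blast
  show "((\<lambda>t. z (ereal t) $ i) \<longlongrightarrow> z (ereal t) $ i) (at t within K \<inter> {t<..})"
    "\<exists>l. ((\<lambda>t. z (ereal t) $ i) \<longlongrightarrow> l) (at t within K \<inter> {..<t})"
    using assms(1) t sub unfolding cadlag_on_def by blast+
qed

lemma t1_space_S_halfline:
  "t1_space (sequential_topology (skorokhod_space {0..<\<infinity>} :: (ereal \<Rightarrow> real ^ 'd) set) S_converges_halfline)"
proof (rule t1_space_sequential_topology)
  fix \<eta> \<omega> :: "ereal \<Rightarrow> real ^ 'd"
  assume sp: "\<eta> \<in> skorokhod_space {0..<\<infinity>}" "\<omega> \<in> skorokhod_space {0..<\<infinity>}"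
    and conv: "S_converges_halfline (\<lambda>_. \<eta>) \<omega>"
  have J: "ereal -` {0..<\<infinity>} = {0..}" by auto
  have "\<omega> (ereal t) $ i = \<eta> (ereal t) $ i" if "0 \<le> t" for t i
  proof -
    obtain T :: "nat \<Rightarrow> real" where T: "filterlim T at_top sequentially"
      and S: "\<And>r. S_converges_real (T r) (\<lambda>n t. \<eta> (ereal t) $ i) (\<lambda>t. \<omega> (ereal t) $ i)"
      using conv unfolding S_converges_halfline_def by metis
    \<comment> \<open>The horizons depend on the component \<open>i\<close>, but they tend to
      infinity, so one of them lies beyond \<open>t\<close>.\<close>
    obtain r where "t \<le> T r"
      using T by (metis eventually_happens filterlim_at_top trivial_limit_sequentially)
    moreover have "cadlag_on {0..T r} (\<lambda>t. z (ereal t) $ i)"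
      if "z \<in> skorokhod_space {0..<\<infinity>}" for z :: "ereal \<Rightarrow> real ^ 'd"
      by (rule cadlag_on_component[of "{0..}"]) (use that in \<open>auto simp: skorokhod_space_def J\<close>)
    ultimately show ?thesis
      using S_converges_real_const_imp_eq[OF S, of r t] sp that by auto
  qed
  then have "\<omega> s = \<eta> s" if "s \<in> {0..<\<infinity>}" for s
    using that by (cases s) (auto simp: vec_eq_iff)
  then show "\<omega> = \<eta>"
    using sp by (auto simp: skorokhod_space_def intro: extensionalityI)
qed

lemma t1_space_S_compact:
  assumes "0 \<le> T"
  shows "t1_space (sequential_topology (skorokhod_space {0..ereal T} :: (ereal \<Rightarrow> real ^ 'd) set) (S_converges_compact T))"
proof (rule t1_space_sequential_topology)
  fix \<eta> \<omega> :: "ereal \<Rightarrow> real ^ 'd"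
  assume sp: "\<eta> \<in> skorokhod_space {0..ereal T}" "\<omega> \<in> skorokhod_space {0..ereal T}"
    and conv: "S_converges_compact T (\<lambda>_. \<eta>) \<omega>"
  have J: "ereal -` {0..ereal T} = {0..T}" by auto
  have "cadlag_on {0..T} (\<lambda>t. z (ereal t) $ i)"
    if "z \<in> skorokhod_space {0..ereal T}" for z :: "ereal \<Rightarrow> real ^ 'd" and i
    by (rule cadlag_on_component[of "{0..T}"]) (use that in \<open>auto simp: skorokhod_space_def J\<close>)
  then have "\<omega> (ereal t) $ i = \<eta> (ereal t) $ i" if "t \<in> {0..T}" for t i
    using conv sp that S_converges_real_const_imp_eq unfolding S_converges_compact_def by blast
  then have "\<omega> s = \<eta> s" if "s \<in> {0..ereal T}" for s
    using that by (cases s) (auto simp: vec_eq_iff)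
  then show "\<omega> = \<eta>"
    using sp by (auto simp: skorokhod_space_def intro: extensionalityI)
qed

lemma t1_and_sequential_S_topology:
  assumes "(\<exists>T>0. I = {0..T}) \<or> I = {0..<\<infinity>}"
  shows "t1_space (S_topology I :: (ereal \<Rightarrow> real ^ 'd) topology) \<and> sequential_space (S_topology I :: (ereal \<Rightarrow> real ^ 'd) topology)"
proof -
  \<comment> \<open>\<open>S_topology\<close> branches on equality of time sets, so the three kinds
    of interval must be told apart; a finite time beyond \<open>T\<close> and the point at infinity
    do this.\<close>
  have ne: "{0..ereal T} \<noteq> {0..<\<infinity>}" "{0..ereal T} \<noteq> {0..\<infinity>}" for T
  proof -
    have "ereal (max 0 T + 1) \<notin> {0..ereal T}" "ereal (max 0 T + 1) \<in> {0..<\<infinity>}"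
      "ereal (max 0 T + 1) \<in> {0..\<infinity>}"
      by auto
    then show "{0..ereal T} \<noteq> {0..<\<infinity>}" "{0..ereal T} \<noteq> {0..\<infinity>}" by metis+
  qed
  have ne': "{0..\<infinity>::ereal} \<noteq> {0..<\<infinity>}"
  proof -
    have "\<infinity> \<in> {0..\<infinity>::ereal}" "\<infinity> \<notin> {0..<\<infinity>::ereal}" by auto
    then show ?thesis by metis
  qed
  \<comment> \<open>The horizon in the hypothesis is extended real, so its infinite value accounts
    for the closed half-line.\<close>
  consider "I = {0..<\<infinity>}" | "I = {0..\<infinity>}" | T where "T > 0" "I = {0..ereal T}"
  proof -
    have "(\<exists>r>0. T = ereal r) \<or> T = \<infinity>" if "0 < T" for T
      using that by (cases T) auto
    then show thesis using assms that by blast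
  qed
  then show ?thesis
  proof cases
    case 1
    then show ?thesis
      by (simp add: S_topology_def t1_space_S_halfline sequential_space_sequential_topology)
  next
    case 2
    let ?H = "sequential_topology (skorokhod_space {0..<\<infinity>} :: (ereal \<Rightarrow> real ^ 'd) set) S_converges_halfline"
    have "t1_space (prod_topology ?H (euclidean :: (real ^ 'd) topology))"
      using t1_space_S_halfline by (auto simp: t1_space_prod_topology intro: Hausdorff_imp_t1_space)
    moreover have "sequential_space (prod_topology ?H (euclidean :: (real ^ 'd) topology))"
      by (intro sequential_space_prod_euclidean sequential_space_sequential_topology)
    ultimately show ?thesis
      using skorokhod_space_extended_halfline[where 'a = "real ^ 'd"]
      by (auto simp: S_topology_def 2 ne' bij_betw_def
          intro!: t1_space_pullback_topology sequential_space_pullback_topology)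
  next
    case 3
    then have "real_of_ereal (Sup I) = T" by simp
    with 3 show ?thesis
      by (simp add: S_topology_def ne t1_space_S_compact sequential_space_sequential_topology)
  qed
qed

theorem theorem5p5:
  fixes I :: "ereal set"
    and \<T> :: "(ereal \<Rightarrow> real ^ 'd::finite) topology"
  assumes "(\<exists>T>0. I = {0..T}) \<or> I = {0..<\<infinity>}"
    and "topspace \<T> = skorokhod_space I"
    and "Hausdorff_space \<T>"
    and "completely_regular_space \<T>"
    and "souslin_space TYPE('b) \<T>"
    and "(\<forall>U. openin \<T> U \<longrightarrow> openin (S_topology I) U) \<or>
         (\<forall>U. openin (S_topology I) U \<longrightarrow> openin \<T> U)"
    and "{K. compactin \<T> K} = {K. compactin (S_topology I) K}"
  shows "\<forall>U. openin \<T> U \<longrightarrow> openin (S_topology I) U"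
proof (intro allI impI)
  fix U assume U: "openin \<T> U"
  have Y: "t1_space (S_topology I :: (ereal \<Rightarrow> real ^ 'd) topology)"
    "sequential_space (S_topology I :: (ereal \<Rightarrow> real ^ 'd) topology)"
    using t1_and_sequential_S_topology[OF assms(1)] by blast+
  show "openin (S_topology I) U"
    by (rule openin_same_compact[OF assms(3) Y _ _ U]) (use assms(2,7) in auto)
qed

end
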